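(* Let $q>0$, let $\hat{\mathcal A}=\mathbb C\langle \hat x,\hat p\rangle/\langle \hat p\hat x-q\hat x\hat p\rangle$ be the coordinate algebra of the quantum plane with its $q$-exterior algebra $\Omega(\hat{\mathcal A})$, let $\hat H\in\hat{\mathcal A}$, let $\hat\omega=q^{-1/2}\,d\hat x\wedge d\hat p$ be the $q$-symplectic form, and let $\hat X_{\hat H}=\dot{\hat x}\,\hat\partial_{\hat x}+\dot{\hat p}\,\hat\partial_{\hat p}$ be the formal $q$-Hamiltonian vector field with components $\dot{\hat x}=q^{-1/2}(\hat\partial_{\hat p}\hat H)^L$ and $\dot{\hat p}=-q^{1/2}(\hat\partial_{\hat x}\hat H)^L$. Then $\hat X_{\hat H}$ preserves $\hat\omega$ in the infinitesimal sense $$\mathcal L_{\hat X_{\hat H}}\hat\omega=0,$$ where $\mathcal L$ is the formal Lie derivative defined by the Cartan formula. Equivalently, the formal $q$-Hamiltonian flow generated by $\hat X_{\hat H}$, when interpreted within the $q$-deformed differential calculus, preserves $\hat\omega$ (this preservation being understood as the vanishing of the formal Lie derivative).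
   Context: Quantum plane: $\hat{\mathcal A}$ is the unital associative $\mathbb C$-algebra generated by $\hat x,\hat p$ subject to $\hat p\hat x=q\hat x\hat p$, where $q>0$ is the deformation parameter ($q\neq 1$ in the deformed case; $q=1$ is the classical commutative case). One-forms: $\Omega^1(\hat{\mathcal A})$ is the module generated by $d\hat x,d\hat p$, with coordinates and differentials satisfying $\hat x\,d\hat p=q\,d\hat p\,\hat x$, $\ \hat p\,d\hat x=q\,d\hat x\,\hat p+(q^2-1)\,d\hat p\,\hat x$, $\ \hat x\,d\hat x=q^2\,d\hat x\,\hat x$, $\ \hat p\,d\hat p=q^2\,d\hat p\,\hat p$. One-forms are written with basis differentials on the left and coefficients on the right. Exterior algebra: $\Omega(\hat{\mathcal A})=\bigoplus_{k=0}^2\Omega^k(\hat{\mathcal A})$ with $\Omega^0(\hat{\mathcal A})=\hat{\mathcal A}$, $\Omega^2(\hat{\mathcal A})$ generated by $d\hat x\wedge d\hat p$, $\Omega^k(\hat{\mathcal A})=0$ for $k\ge 3$, and $d\hat p\wedge d\hat x=-q^{-1}d\hat x\wedge d\hat p$. The $q$-exterior derivative $d$ is compatible with the relations above and is nilpotent, $d^2=0$. $q$-derivatives: $\hat\partial_{\hat x},\hat\partial_{\hat p}$ act on generators by $\hat\partial_{\hat x}(\hat x)=1$, $\hat\partial_{\hat x}(\hat p)=0$, $\hat\partial_{\hat p}(\hat x)=0$, $\hat\partial_{\hat p}(\hat p)=1$, and satisfy the operator relations $\hat\partial_{\hat p}\hat x=q\hat x\hat\partial_{\hat p}$, $\ \hat\partial_{\hat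 x}\hat p=q\hat p\hat\partial_{\hat x}$, $\ \hat\partial_{\hat p}\hat p=1+q^2\hat p\hat\partial_{\hat p}+(q^2-1)\hat x\hat\partial_{\hat x}$, $\ \hat\partial_{\hat x}\hat x=1+q^2\hat x\hat\partial_{\hat x}$, $\ \hat\partial_{\hat p}\hat\partial_{\hat x}=q^{-1}\hat\partial_{\hat x}\hat\partial_{\hat p}$. The superscript $L$ denotes the left action of a derivative on a function, and for $\hat F\in\hat{\mathcal A}$, $d\hat F=d\hat x\,(\hat\partial_{\hat x}\hat F)^L+d\hat p\,(\hat\partial_{\hat p}\hat F)^L$. Interior product: $i_{\hat X}$ denotes the $q$-deformed interior product (a linear contraction on $q$-forms). For the vector field $\hat X_{\hat H}=\dot{\hat x}\hat\partial_{\hat x}+\dot{\hat p}\hat\partial_{\hat p}$, the $q$-contraction rules and ordering convention give $$i_{\hat X_{\hat H}}\hat\omega=d\hat x\,(-q^{-1/2}\dot{\hat p})+d\hat p\,(q^{1/2}\dot{\hat x}),$$ so that the component equations $\dot{\hat x}=q^{-1/2}(\hat\partial_{\hat p}\hat H)^L$, $\dot{\hat p}=-q^{1/2}(\hat\partial_{\hat x}\hat H)^L$ are equivalently summarized by the one-form identity $i_{\hat X_{\hat H}}\hat\omega=d\hat H$. Formal Lie derivative (definition): for $\hat\eta\in\Omega(\hat{\mathcal A})$, $\mathcal L_{\hat X}\hat\eta:=d(i_{\hat X}\hat\eta)+i_{\hat X}(d\hat\eta)$. *)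

theory Defs
  imports Complex_Main "HOL-Library.Poly_Mapping" "HOL-Algebra.QuotRing"
begin

section \<open>Free complex algebras\<close>

text \<open>The free unital associative complex algebra on a set of letters is the monoid algebra of
  the free monoid of words.  The words get their own type because the product of
  \<^typ>\<open>'a \<Rightarrow>\<^sub>0 'b\<close> is the convolution along an additively written monoid.\<close>

datatype 'g word_monoid = Word (letters: "'g list")

instantiation word_monoid :: (type) monoid_add
begin
definition zero_word_monoid :: "'a word_monoid" where
  "zero_word_monoid = Word []"
definition plus_word_monoid :: "'a word_monoid \<Rightarrow> 'a word_monoid \<Rightarrow> 'a word_monoid" where
  "plus_word_monoid u v = Word (letters u @ letters v)"
instance
  by standard (simp_all add: zero_word_monoid_def plus_word_monoid_def)
end

type_synonym 'g free = "'g word_monoid \<Rightarrow>\<^sub>0 complex"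

definition mon :: "'g list \<Rightarrow> 'g free" where
  "mon w = Poly_Mapping.single (Word w) 1"

abbreviation gen :: "'g \<Rightarrow> 'g free" where
  "gen g \<equiv> mon [g]"

definition scalar :: "complex \<Rightarrow> 'g free" where
  "scalar c = Poly_Mapping.single 0 c"

abbreviation rscalar :: "real \<Rightarrow> 'g free" where
  "rscalar r \<equiv> scalar (complex_of_real r)"

definition lin_ext :: "('g list \<Rightarrow> 'h free) \<Rightarrow> 'g free \<Rightarrow> 'h free" where
  "lin_ext \<phi> f = (\<Sum>w\<in>Poly_Mapping.keys f. scalar (Poly_Mapping.lookup f w) * \<phi> (letters w))"

definition free_algebra :: "'g free ring" where
  "free_algebra = \<lparr>carrier = UNIV, mult = (*), one = 1, zero = 0, add = (+)\<rparr>"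

lemma free_algebra_ring: "ring (free_algebra :: 'g free ring)"
proof (rule ringI)
  show "abelian_group (free_algebra :: 'g free ring)"
  proof (rule abelian_groupI)
    fix x :: "'g free"
    have "- x + x = 0" by simp
    then show "\<exists>y\<in>carrier free_algebra. y \<oplus>\<^bsub>free_algebra\<^esub> x = \<zero>\<^bsub>free_algebra\<^esub>"
      by (auto simp: free_algebra_def intro: exI[of _ "- x"])
  qed (simp_all add: free_algebra_def algebra_simps)
  show "Group.monoid (free_algebra :: 'g free ring)"
    by (rule Group.monoidI) (simp_all add: free_algebra_def algebra_simps)
qed (simp_all add: free_algebra_def algebra_simps)

text \<open>The map induced on cosets, with target the quotient by \<open>J\<close>, by a map \<open>\<phi>\<close> of representatives
  (cf. \<^const>\<open>rcoset_mult\<close>).\<close>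

definition quot_map :: "'h free set \<Rightarrow> ('g free \<Rightarrow> 'h free) \<Rightarrow> 'g free set \<Rightarrow> 'h free set" where
  "quot_map J \<phi> S = (\<Union>f\<in>S. J +>\<^bsub>free_algebra\<^esub> \<phi> f)"


section \<open>The quantum plane\<close>

datatype coord = X | P

definition plane_ideal :: "real \<Rightarrow> coord free set" where
  "plane_ideal q = Idl\<^bsub>free_algebra\<^esub> {gen P * gen X - rscalar q * gen X * gen P}"

definition plane :: "real \<Rightarrow> coord free set ring" where
  "plane q = free_algebra Quot plane_ideal q"

definition plane_scalar :: "real \<Rightarrow> real \<Rightarrow> coord free set" where
  "plane_scalar q r = plane_ideal q +>\<^bsub>free_algebra\<^esub> rscalar r"


section \<open>The \<open>q\<close>-derivatives\<close>

text \<open>On words, the clauses are the operator relations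
  \<open>\<partial>\<^sub>x x = 1 + q\<^sup>2 x \<partial>\<^sub>x\<close>, \<open>\<partial>\<^sub>x p = q p \<partial>\<^sub>x\<close>, \<open>\<partial>\<^sub>p x = q x \<partial>\<^sub>p\<close> and
  \<open>\<partial>\<^sub>p p = 1 + q\<^sup>2 p \<partial>\<^sub>p + (q\<^sup>2 - 1) x \<partial>\<^sub>x\<close>, moving the derivative from the left through
  the word.  They descend to the quantum plane, where also
  \<open>\<partial>\<^sub>p \<partial>\<^sub>x = q\<^sup>-\<^sup>1 \<partial>\<^sub>x \<partial>\<^sub>p\<close> holds.\<close>

primrec dx_word :: "real \<Rightarrow> coord list \<Rightarrow> coord free" where
  "dx_word q [] = 0"
| "dx_word q (g # w) = (case g of
      X \<Rightarrow> mon w + rscalar (q^2) * gen X * dx_word q w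
    | P \<Rightarrow> rscalar q * gen P * dx_word q w)"

primrec dp_word :: "real \<Rightarrow> coord list \<Rightarrow> coord free" where
  "dp_word q [] = 0"
| "dp_word q (g # w) = (case g of
      X \<Rightarrow> rscalar q * gen X * dp_word q w
    | P \<Rightarrow> mon w + rscalar (q^2) * gen P * dp_word q w + rscalar (q^2 - 1) * gen X * dx_word q w)"

definition partial_x :: "real \<Rightarrow> coord free set \<Rightarrow> coord free set" where
  "partial_x q = quot_map (plane_ideal q) (lin_ext (dx_word q))"

definition partial_p :: "real \<Rightarrow> coord free set \<Rightarrow> coord free set" where
  "partial_p q = quot_map (plane_ideal q) (lin_ext (dp_word q))"


section \<open>The \<open>q\<close>-exterior algebra\<close>

datatype form_gen = Co coord | Di coord

abbreviation gx :: "form_gen free" where "gx \<equiv> gen (Co X)"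
abbreviation gp :: "form_gen free" where "gp \<equiv> gen (Co P)"
abbreviation gdx :: "form_gen free" where "gdx \<equiv> gen (Di X)"
abbreviation gdp :: "form_gen free" where "gdp \<equiv> gen (Di P)"

text \<open>The exterior algebra is presented by \<open>x, p, dx, dp\<close>; its product is the wedge product
  together with both module actions.  The relations \<open>dx \<and> dx = 0\<close> and \<open>dp \<and> dp = 0\<close> express that
  the two-forms are generated by \<open>dx \<and> dp\<close> and that there are no forms of degree three; they
  also follow from applying \<open>d\<close> to the relations for \<open>x dx\<close> and \<open>p dp\<close>, as \<open>1 + q\<^sup>2 \<noteq> 0\<close>.\<close>

definition form_relations :: "real \<Rightarrow> form_gen free set" where
  "form_relations q =
    {gp * gx - rscalar q * gx * gp,
     gx * gdp - rscalar q * gdp * gx,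
     gp * gdx - (rscalar q * gdx * gp + rscalar (q^2 - 1) * gdp * gx),
     gx * gdx - rscalar (q^2) * gdx * gx,
     gp * gdp - rscalar (q^2) * gdp * gp,
     gdp * gdx - rscalar (- inverse q) * gdx * gdp,
     gdx * gdx,
     gdp * gdp}"

definition form_ideal :: "real \<Rightarrow> form_gen free set" where
  "form_ideal q = Idl\<^bsub>free_algebra\<^esub> (form_relations q)"

definition forms :: "real \<Rightarrow> form_gen free set ring" where
  "forms q = free_algebra Quot form_ideal q"

definition form_class :: "real \<Rightarrow> form_gen free \<Rightarrow> form_gen free set" where
  "form_class q f = form_ideal q +>\<^bsub>free_algebra\<^esub> f"

text \<open>The inclusion of the quantum plane as the algebra of zero-forms.\<close>

definition zero_form :: "real \<Rightarrow> coord free set \<Rightarrow> form_gen free set" where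
  "zero_form q = quot_map (form_ideal q) (lin_ext (\<lambda>w. mon (map Co w)))"

text \<open>The exterior derivative is the graded derivation with \<open>x \<mapsto> dx\<close>, \<open>p \<mapsto> dp\<close>,
  \<open>dx \<mapsto> 0\<close> and \<open>dp \<mapsto> 0\<close>.\<close>

primrec d_word :: "form_gen list \<Rightarrow> form_gen free" where
  "d_word [] = 0"
| "d_word (g # w) = (case g of
      Co c \<Rightarrow> gen (Di c) * mon w + gen (Co c) * d_word w
    | Di c \<Rightarrow> - (gen (Di c) * d_word w))"

definition ext_d :: "real \<Rightarrow> form_gen free set \<Rightarrow> form_gen free set" where
  "ext_d q = quot_map (form_ideal q) (lin_ext d_word)"


section \<open>Vector fields, interior product and Lie derivative\<close>

text \<open>The pair \<open>(a, b)\<close> stands for the vector field \<open>a \<partial>\<^sub>x + b \<partial>\<^sub>p\<close>.\<close>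

type_synonym vector_field = "coord free set \<times> coord free set"

text \<open>One-forms with the differentials on the left and the coefficients on the right.\<close>

definition one_form :: "real \<Rightarrow> coord free set \<Rightarrow> coord free set \<Rightarrow> form_gen free set" where
  "one_form q f g =
    (form_class q gdx \<otimes>\<^bsub>forms q\<^esub> zero_form q f) \<oplus>\<^bsub>forms q\<^esub>
    (form_class q gdp \<otimes>\<^bsub>forms q\<^esub> zero_form q g)"

definition two_form :: "real \<Rightarrow> coord free set \<Rightarrow> form_gen free set" where
  "two_form q h =
    (form_class q gdx \<otimes>\<^bsub>forms q\<^esub> form_class q gdp) \<otimes>\<^bsub>forms q\<^esub> zero_form q h"

text \<open>The contraction \<open>i\<^sub>X\<close> for \<open>X = a \<partial>\<^sub>x + b \<partial>\<^sub>p\<close> is the map, linear over the coefficients on the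
  right, with \<open>i\<^sub>X 1 = 0\<close>, \<open>i\<^sub>X dx = a\<close>, \<open>i\<^sub>X dp = b\<close> and \<open>i\<^sub>X (dx \<and> dp) = dx (- b) + dp (q a)\<close>.
  The last rule contracts the right factor of \<open>dx \<and> dp\<close>, with a sign, and the right factor of
  \<open>- q dp \<and> dx\<close>; for \<open>q\<^sup>-\<^sup>1\<^sup>/\<^sup>2 dx \<and> dp\<close> it gives \<open>dx (- q\<^sup>-\<^sup>1\<^sup>/\<^sup>2 b) + dp (q\<^sup>1\<^sup>/\<^sup>2 a)\<close>.
  For \<open>q > 0\<close> the forms are a free right module on \<open>1, dx, dp, dx \<and> dp\<close>, so that the
  description is definite.\<close>

definition interior :: "real \<Rightarrow> vector_field \<Rightarrow> form_gen free set \<Rightarrow> form_gen free set" where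
  "interior q = (\<lambda>(a, b) \<eta>. THE \<theta>.
    \<exists>e \<in> carrier (plane q). \<exists>f \<in> carrier (plane q). \<exists>g \<in> carrier (plane q). \<exists>h \<in> carrier (plane q).
      \<eta> = zero_form q e \<oplus>\<^bsub>forms q\<^esub> one_form q f g \<oplus>\<^bsub>forms q\<^esub> two_form q h \<and>
      \<theta> = zero_form q ((a \<otimes>\<^bsub>plane q\<^esub> f) \<oplus>\<^bsub>plane q\<^esub> (b \<otimes>\<^bsub>plane q\<^esub> g)) \<oplus>\<^bsub>forms q\<^esub>
          one_form q (\<ominus>\<^bsub>plane q\<^esub> (b \<otimes>\<^bsub>plane q\<^esub> h))
            (plane_scalar q q \<otimes>\<^bsub>plane q\<^esub> a \<otimes>\<^bsub>plane q\<^esub> h))"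

definition lie_derivative :: "real \<Rightarrow> vector_field \<Rightarrow> form_gen free set \<Rightarrow> form_gen free set" where
  "lie_derivative q V \<eta> =
    ext_d q (interior q V \<eta>) \<oplus>\<^bsub>forms q\<^esub> interior q V (ext_d q \<eta>)"

definition symplectic_form :: "real \<Rightarrow> form_gen free set" where
  "symplectic_form q =
    form_class q (rscalar (q powr (- 1/2))) \<otimes>\<^bsub>forms q\<^esub>
      (form_class q gdx \<otimes>\<^bsub>forms q\<^esub> form_class q gdp)"

definition hamiltonian_field :: "real \<Rightarrow> coord free set \<Rightarrow> vector_field" where
  "hamiltonian_field q H =
    (plane_scalar q (q powr (- 1/2)) \<otimes>\<^bsub>plane q\<^esub> partial_p q H,
     \<ominus>\<^bsub>plane q\<^esub> (plane_scalar q (q powr (1/2)) \<otimes>\<^bsub>plane q\<^esub> partial_x q H))"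

end

theory Submission
  imports Defs
begin

text \<open>
  The proof of \<open>L\<^sub>H \<omega> = 0\<close> is Cartan's: \<open>\<omega>\<close> is closed because \<open>d (dx \<and> dp) = 0\<close>, the contraction
  \<open>i\<^sub>H \<omega>\<close> is the exact form \<open>dH\<close>, and \<open>d d = 0\<close>.  The powers of \<open>q\<close> in the field and in \<open>\<omega>\<close>
  cancel: \<open>q\<^sup>1\<^sup>/\<^sup>2 q\<^sup>-\<^sup>1\<^sup>/\<^sup>2 = 1\<close> in front of \<open>dx\<close>, and \<open>q q\<^sup>-\<^sup>1\<^sup>/\<^sup>2 q\<^sup>-\<^sup>1\<^sup>/\<^sup>2 = 1\<close> in front of \<open>dp\<close>.

  The work lies in making sense of these equations in algebras given by generators and relations.
  All operations are computed on representatives in free algebras, so it has to be shown that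
  they respect the two ideals, and that the contraction is single-valued.  Three facts suffice.

  \<^item> \<open>d\<close> maps the ideal of the forms into itself (\<open>deriv_form_ideal\<close>).  By the graded Leibniz rule
    this need only be checked on the relations, provided that one carries the degree involution
    along.

  \<^item> The forms are a free right module on \<open>1, dx, dp, dx \<and> dp\<close> over the quantum plane
    (\<open>form_rep_in_ideal_iff\<close>).  Independence is read off from a representation of the forms by
    four by four matrices over the quantum plane, namely left multiplication written in that basis.

  \<^item> \<open>dF = dx \<partial>\<^sub>x F + dp \<partial>\<^sub>p F\<close> (\<open>deriv_incl\<close>), by induction on words: moving a
    coordinate past \<open>dx\<close> and \<open>dp\<close> mirrors moving \<open>\<partial>\<^sub>x\<close> and \<open>\<partial>\<^sub>p\<close> past that coordinate.

  Freeness makes the contraction single-valued.  Together the three facts also show that the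
  derivatives descend to the quantum plane: if \<open>F\<close> vanishes there, then so does the form \<open>dF\<close>, and
  hence so do its coefficients \<open>\<partial>\<^sub>x F\<close> and \<open>\<partial>\<^sub>p F\<close>.
\<close>

section \<open>Linear maps on free algebras\<close>

lemma mon_mult: "mon u * mon v = mon (u @ v)"
  by (simp add: mon_def mult_single plus_word_monoid_def)

lemma mon_Nil: "mon [] = 1"
  by (simp add: mon_def flip: zero_word_monoid_def)

lemma single_eq_scalar_mon: "Poly_Mapping.single w c = scalar c * mon (letters w)"
  by (simp add: scalar_def mon_def mult_single)

lemma scalar_mult: "scalar (a * b) = scalar a * scalar b"
  by (simp add: scalar_def mult_single)

lemma scalar_add: "scalar (a + b) = scalar a + scalar b"
  by (simp add: scalar_def single_add)

lemma scalar_diff: "scalar (a - b) = scalar a - scalar b"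
  by (simp add: scalar_def single_diff)

lemma scalar_minus: "scalar (- a) = - scalar a"
  by (simp add: scalar_def single_uminus)

lemma scalar_1 [simp]: "scalar 1 = 1"
  by (simp add: scalar_def)

lemma scalar_0 [simp]: "scalar 0 = 0"
  by (simp add: scalar_def)

text \<open>Two linear maps agree once they agree on words; most identities below are proved by this
  induction, used for one factor of a product at a time.\<close>

lemma free_induct [case_names add scale mon]:
  fixes f :: "'g free"
  assumes add: "\<And>f g. Q f \<Longrightarrow> Q g \<Longrightarrow> Q (f + g)"
    and scale: "\<And>c f. Q f \<Longrightarrow> Q (scalar c * f)"
    and mon: "\<And>w. Q (mon w)"
  shows "Q f"
proof (induction f rule: Poly_Mapping.update_induct)
  case const
  have "Q (scalar 0 * mon [])"
    by (intro scale mon)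
  then show ?case by simp
next
  case (update f a b)
  have "Poly_Mapping.update a b f = f + Poly_Mapping.single a b"
    using update(1) by (intro poly_mapping_eqI)
      (auto simp: lookup_update lookup_add lookup_single when_def in_keys_iff)
  then show ?case
    using update by (auto simp: single_eq_scalar_mon intro: add scale mon)
qed

lemma scalar_central: "f * scalar c = scalar c * f"
proof (induction f rule: free_induct)
  case (scale b f)
  have "scalar b * (scalar c * f) = scalar (b * c) * f"
    by (simp add: scalar_mult mult.assoc)
  also have "\<dots> = scalar c * (scalar b * f)"
    by (subst mult.commute) (simp add: scalar_mult mult.assoc)
  finally show ?case
    using scale by (simp add: mult.assoc)
qed (simp_all add: distrib_left distrib_right mon_def scalar_def mult_single)

lemma scalar_left_commute: "f * (scalar c * g) = scalar c * (f * g)"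
  by (metis mult.assoc scalar_central)

lemma scalar_mult_assoc: "scalar a * (scalar b * f) = scalar (a * b) * f"
  by (simp add: scalar_mult mult.assoc)

lemma lin_ext_superset:
  assumes "finite A" "Poly_Mapping.keys f \<subseteq> A"
  shows "lin_ext \<phi> f = (\<Sum>w\<in>A. scalar (Poly_Mapping.lookup f w) * \<phi> (letters w))"
  unfolding lin_ext_def using assms
  by (intro sum.mono_neutral_left) (auto simp: in_keys_iff)

lemma lin_ext_add: "lin_ext \<phi> (f + g) = lin_ext \<phi> f + lin_ext \<phi> g"
proof -
  define A where "A = Poly_Mapping.keys f \<union> Poly_Mapping.keys g"
  have A: "finite A" "Poly_Mapping.keys f \<subseteq> A" "Poly_Mapping.keys g \<subseteq> A"
    "Poly_Mapping.keys (f + g) \<subseteq> A"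
    using Poly_Mapping.keys_add[of f g] by (auto simp: A_def)
  show ?thesis
    by (simp add: lin_ext_superset[OF A(1)] A lookup_add scalar_add distrib_right sum.distrib)
qed

lemma lin_ext_single:
  "lin_ext \<phi> (Poly_Mapping.single w c) = scalar c * \<phi> (letters w)"
  by (subst lin_ext_superset[of "{w}"]) auto

lemma lin_ext_mon: "lin_ext \<phi> (mon w) = \<phi> w"
  by (simp add: mon_def lin_ext_single)

lemma lin_ext_one: "lin_ext \<phi> 1 = \<phi> []"
  using lin_ext_mon[of \<phi> "[]"] by (simp add: mon_Nil)

lemma lin_ext_scale: "lin_ext \<phi> (scalar c * f) = scalar c * lin_ext \<phi> f"
proof -
  have "scalar c * f = Poly_Mapping.map ((*) c) f"
    by (simp add: scalar_def mult_map_scale_conv_mult)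
  then have lookup: "Poly_Mapping.lookup (scalar c * f) w = c * Poly_Mapping.lookup f w" for w
    by (simp add: Poly_Mapping.map.rep_eq when_def)
  then have "Poly_Mapping.keys (scalar c * f) \<subseteq> Poly_Mapping.keys f"
    by (auto simp: in_keys_iff)
  then show ?thesis
    by (simp add: lin_ext_superset[of "Poly_Mapping.keys f"] lookup scalar_mult mult.assoc
        sum_distrib_left)
qed

lemma lin_ext_0: "lin_ext \<phi> 0 = 0"
  by (simp add: lin_ext_def)

lemma lin_ext_minus: "lin_ext \<phi> (- f) = - lin_ext \<phi> f"
  using lin_ext_add[of \<phi> f "- f"] by (simp add: lin_ext_0 eq_neg_iff_add_eq_0 add.commute)

lemma lin_ext_diff: "lin_ext \<phi> (f - g) = lin_ext \<phi> f - lin_ext \<phi> g"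
  using lin_ext_add[of \<phi> f "- g"] by (simp add: lin_ext_minus)

lemmas lin_ext_linear = lin_ext_add lin_ext_scale lin_ext_0 lin_ext_minus lin_ext_diff

text \<open>Rewriting with these rules brings an expression to a sum of terms, each a single scalar
  times a word or a product with opaque factors, so that equality becomes syntactic.\<close>

lemmas free_simps = distrib_left distrib_right left_diff_distrib right_diff_distrib mult.assoc
  scalar_left_commute[of "mon w" for w] scalar_central[of "mon w" for w]
  scalar_mult_assoc scalar_add scalar_diff scalar_minus scalar_mult[symmetric]

lemma lin_ext_hom:
  assumes "\<And>u v. \<phi> (u @ v) = \<phi> u * \<phi> v"
  shows "lin_ext \<phi> (f * g) = lin_ext \<phi> f * lin_ext \<phi> g"
proof (induction f rule: free_induct)
  case (mon u)
  show ?case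
    by (induction g rule: free_induct)
      (simp_all add: lin_ext_linear distrib_left scalar_left_commute mon_mult lin_ext_mon assms)
qed (simp_all add: lin_ext_linear distrib_right mult.assoc)


section \<open>Quotients of free algebras\<close>

lemma ideal_closed:
  assumes "ideal J free_algebra"
  shows "0 \<in> J"
    and "f \<in> J \<Longrightarrow> g \<in> J \<Longrightarrow> f + g \<in> J"
    and "f \<in> J \<Longrightarrow> h * f \<in> J"
    and "f \<in> J \<Longrightarrow> f * h \<in> J"
    and "f \<in> J \<Longrightarrow> - f \<in> J"
    and "f \<in> J \<Longrightarrow> g \<in> J \<Longrightarrow> f - g \<in> J"
proof -
  interpret ideal J free_algebra by fact
  show "0 \<in> J" and add: "\<And>f g. f \<in> J \<Longrightarrow> g \<in> J \<Longrightarrow> f + g \<in> J"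
    and l: "\<And>f h. f \<in> J \<Longrightarrow> h * f \<in> J" and "f \<in> J \<Longrightarrow> f * h \<in> J"
    using additive_subgroup.zero_closed[OF additive_subgroup_axioms]
      additive_subgroup.a_closed[OF additive_subgroup_axioms] I_l_closed I_r_closed
    by (auto simp: free_algebra_def)
  show neg: "\<And>f. f \<in> J \<Longrightarrow> - f \<in> J"
    using l[where h = "- 1"] by simp
  show "f \<in> J \<Longrightarrow> g \<in> J \<Longrightarrow> f - g \<in> J"
    using add[of f "- g"] neg[of g] by simp
qed

lemma free_algebra_minus: "\<ominus>\<^bsub>free_algebra\<^esub> f = - f"
proof -
  interpret ring "free_algebra :: 'a free ring" by (rule free_algebra_ring)
  show ?thesis
    by (rule minus_equality) (auto simp: free_algebra_def)
qed

lemma idealI_free_algebra: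
  assumes "0 \<in> J"
    and "\<And>f g. f \<in> J \<Longrightarrow> g \<in> J \<Longrightarrow> f + g \<in> J"
    and l: "\<And>f h. f \<in> J \<Longrightarrow> h * f \<in> J"
    and "\<And>f h. f \<in> J \<Longrightarrow> f * h \<in> J"
  shows "ideal J free_algebra"
proof (rule idealI)
  interpret ring "free_algebra :: 'a free ring" by (rule free_algebra_ring)
  show "subgroup J (add_monoid free_algebra)"
  proof (rule add.subgroupI)
    fix f assume "f \<in> J"
    then show "\<ominus>\<^bsub>free_algebra\<^esub> f \<in> J"
      using l[of f "- 1"] by (simp add: free_algebra_minus)
  qed (use assms in \<open>auto simp: free_algebra_def\<close>)
qed (use assms free_algebra_ring in \<open>auto simp: free_algebra_def\<close>)

lemma ideal_generated: "ideal (Idl\<^bsub>free_algebra\<^esub> S) free_algebra"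
  by (rule ring.genideal_ideal[OF free_algebra_ring]) (simp add: free_algebra_def)

lemma generators_in_ideal: "f \<in> S \<Longrightarrow> f \<in> Idl\<^bsub>free_algebra\<^esub> S"
  using ring.genideal_self[OF free_algebra_ring, of S] by (auto simp: free_algebra_def)

lemma generated_subset_ideal:
  "ideal J free_algebra \<Longrightarrow> S \<subseteq> J \<Longrightarrow> Idl\<^bsub>free_algebra\<^esub> S \<subseteq> J"
  by (rule ring.genideal_minimal[OF free_algebra_ring])

abbreviation cls :: "'g free set \<Rightarrow> 'g free \<Rightarrow> 'g free set" where
  "cls J f \<equiv> J +>\<^bsub>free_algebra\<^esub> f"

lemma mem_cls_iff: "ideal J free_algebra \<Longrightarrow> g \<in> cls J f \<longleftrightarrow> g - f \<in> J"
  by (force simp: a_r_coset_def' free_algebra_def)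

lemma cls_eq_iff:
  assumes "ideal J free_algebra"
  shows "cls J f = cls J g \<longleftrightarrow> f - g \<in> J"
proof
  assume "cls J f = cls J g"
  moreover have "f \<in> cls J f"
    using assms by (simp add: mem_cls_iff ideal_closed)
  ultimately show "f - g \<in> J"
    using assms by (simp add: mem_cls_iff)
next
  assume *: "f - g \<in> J"
  have "h - f \<in> J \<longleftrightarrow> h - g \<in> J" for h
    using ideal_closed(2)[OF assms _ *, of "h - f"] ideal_closed(6)[OF assms _ *, of "h - g"]
    by auto
  then show "cls J f = cls J g"
    using assms by (auto simp: mem_cls_iff)
qed

lemma quotient_operations:
  assumes "ideal J free_algebra"
  shows "cls J f \<otimes>\<^bsub>free_algebra Quot J\<^esub> cls J g = cls J (f * g)"
    and "cls J f \<oplus>\<^bsub>free_algebra Quot J\<^esub> cls J g = cls J (f + g)"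
    and "\<ominus>\<^bsub>free_algebra Quot J\<^esub> cls J f = cls J (- f)"
    and "\<zero>\<^bsub>free_algebra Quot J\<^esub> = cls J 0"
proof -
  interpret ideal J free_algebra by fact
  interpret h: ring_hom_ring free_algebra "free_algebra Quot J" "cls J"
    by (rule rcos_ring_hom_ring)
  have [simp]: "carrier free_algebra = UNIV" "x \<otimes>\<^bsub>free_algebra\<^esub> y = x * y"
    "x \<oplus>\<^bsub>free_algebra\<^esub> y = x + y" "\<zero>\<^bsub>free_algebra\<^esub> = 0" for x y :: "'a free"
    by (auto simp: free_algebra_def)
  show "cls J f \<otimes>\<^bsub>free_algebra Quot J\<^esub> cls J g = cls J (f * g)"
    and "cls J f \<oplus>\<^bsub>free_algebra Quot J\<^esub> cls J g = cls J (f + g)"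
    and "\<zero>\<^bsub>free_algebra Quot J\<^esub> = cls J 0"
    using h.hom_mult[of f g] h.hom_add[of f g] h.hom_zero by simp_all
  show "\<ominus>\<^bsub>free_algebra Quot J\<^esub> cls J f = cls J (- f)"
    using h.hom_a_inv[of f] by (simp add: free_algebra_minus)
qed

lemma carrier_quotient: "carrier (free_algebra Quot J) = range (cls J)"
  unfolding FactRing_def A_RCOSETS_def' by (auto simp: free_algebra_def)

lemma quot_map_cls:
  assumes "ideal I free_algebra" "ideal J free_algebra"
    and "\<And>f. f \<in> I \<Longrightarrow> lin_ext \<phi> f \<in> J"
  shows "quot_map J (lin_ext \<phi>) (cls I f) = cls J (lin_ext \<phi> f)"
proof -
  have "cls J (lin_ext \<phi> g) = cls J (lin_ext \<phi> f)" if "g \<in> cls I f" for g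
    using assms that by (simp add: mem_cls_iff cls_eq_iff flip: lin_ext_diff)
  moreover have "f \<in> cls I f"
    using assms by (simp add: mem_cls_iff ideal_closed)
  ultimately show ?thesis
    unfolding quot_map_def by blast
qed


section \<open>The exterior derivative on representatives\<close>

abbreviation incl :: "coord free \<Rightarrow> form_gen free" where
  "incl \<equiv> lin_ext (\<lambda>w. mon (map Co w))"

abbreviation deriv :: "form_gen free \<Rightarrow> form_gen free" where
  "deriv \<equiv> lin_ext d_word"

text \<open>The degree involution, which is \<open>(-1)\<^sup>k\<close> on \<open>k\<close>-forms.\<close>

primrec sign_word :: "form_gen list \<Rightarrow> form_gen free" where
  "sign_word [] = 1"
| "sign_word (g # w) = (case g of
      Co c \<Rightarrow> gen g * sign_word w
    | Di c \<Rightarrow> - (gen g * sign_word w))"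

abbreviation sign :: "form_gen free \<Rightarrow> form_gen free" where
  "sign \<equiv> lin_ext sign_word"

lemma incl_mult: "incl (f * g) = incl f * incl g"
  by (rule lin_ext_hom) (simp add: mon_mult)

lemma sign_mult: "sign (f * g) = sign f * sign g"
proof (rule lin_ext_hom)
  show "sign_word (u @ v) = sign_word u * sign_word v" for u v
    by (induction u) (auto simp: mult.assoc split: form_gen.split)
qed

lemma incl_scalar: "incl (scalar c) = scalar c"
  using lin_ext_scale[of "\<lambda>w. mon (map Co w)" c 1] by (simp add: lin_ext_one mon_Nil)

lemma deriv_leibniz: "deriv (f * g) = deriv f * g + sign f * deriv g"
proof (induction f rule: free_induct)
  case (mon u)
  show ?case
  proof (induction g rule: free_induct)
    case (mon v)
    have "d_word (u @ v) = d_word u * mon v + sign_word u * d_word v"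
      by (induction u)
        (auto simp: distrib_left distrib_right mult.assoc mon_mult split: form_gen.split)
    then show ?case
      by (simp add: mon_mult lin_ext_mon)
  qed (simp_all add: lin_ext_linear distrib_left scalar_left_commute)
qed (simp_all add: lin_ext_linear distrib_left distrib_right mult.assoc)

lemma deriv_gen_Di: "deriv (gen (Di c) * f) = - (gen (Di c) * deriv f)"
  by (simp add: deriv_leibniz lin_ext_mon mon_Nil)

lemma deriv_gen_Co: "deriv (gen (Co c) * f) = gen (Di c) * f + gen (Co c) * deriv f"
  by (simp add: deriv_leibniz lin_ext_mon mon_Nil)

lemma deriv_scalar: "deriv (scalar c) = 0"
  using lin_ext_scale[of d_word c 1] by (simp add: lin_ext_one)

lemma deriv_deriv: "deriv (deriv f) = 0"
proof (induction f rule: free_induct)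
  case (mon w)
  have "deriv (d_word w) = 0"
  proof (induction w)
    case (Cons g w)
    then show ?case
      by (cases g) (simp_all add: lin_ext_linear deriv_gen_Co deriv_gen_Di lin_ext_mon)
  qed (simp add: lin_ext_linear)
  then show ?case by (simp add: lin_ext_mon)
qed (simp_all add: lin_ext_linear)

lemma plane_ideal: "ideal (plane_ideal q) free_algebra"
  unfolding plane_ideal_def by (rule ideal_generated)

lemma form_ideal: "ideal (form_ideal q) free_algebra"
  unfolding form_ideal_def by (rule ideal_generated)

lemmas plane_closed = ideal_closed[OF plane_ideal]
lemmas form_closed = ideal_closed[OF form_ideal]

lemma form_relations_in_ideal:
  "gp * gx - rscalar q * gx * gp \<in> form_ideal q"
  "gx * gdp - rscalar q * gdp * gx \<in> form_ideal q"
  "gp * gdx - (rscalar q * gdx * gp + rscalar (q^2 - 1) * gdp * gx) \<in> form_ideal q"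
  "gx * gdx - rscalar (q^2) * gdx * gx \<in> form_ideal q"
  "gp * gdp - rscalar (q^2) * gdp * gp \<in> form_ideal q"
  "gdp * gdx - rscalar (- inverse q) * gdx * gdp \<in> form_ideal q"
  "gdx * gdx \<in> form_ideal q"
  "gdp * gdp \<in> form_ideal q"
  unfolding form_ideal_def
  by (rule generators_in_ideal; simp only: form_relations_def insert_iff simp_thms)+

lemma incl_plane_ideal:
  assumes "f \<in> plane_ideal q"
  shows "incl f \<in> form_ideal q"
proof -
  have "plane_ideal q \<subseteq> {f. incl f \<in> form_ideal q}"
    unfolding plane_ideal_def
  proof (rule generated_subset_ideal[OF idealI_free_algebra])
    show "{gen P * gen X - rscalar q * gen X * gen P} \<subseteq> {f. incl f \<in> form_ideal q}"
      using form_relations_in_ideal(1)[of q]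
      by (simp add: lin_ext_linear incl_mult incl_scalar lin_ext_mon)
  qed (auto simp: lin_ext_linear incl_mult form_closed)
  with assms show ?thesis by auto
qed

text \<open>As \<open>d (f g) = df g + \<sigma>(f) dg\<close> with the degree involution \<open>\<sigma>\<close>, the elements of the ideal whose
  images under both \<open>d\<close> and \<open>\<sigma>\<close> lie in the ideal form an ideal, so that it is enough to look at
  the relations.  On the relations, \<open>\<sigma>\<close> is a sign and \<open>d\<close> gives multiples and
  combinations of other relations.\<close>

lemma deriv_form_ideal:
  assumes "q \<noteq> 0" "f \<in> form_ideal q"
  shows "deriv f \<in> form_ideal q"
proof -
  note r = form_relations_in_ideal[of q]
  note c = form_closed[where q = q]
  define K where "K = {f \<in> form_ideal q. sign f \<in> form_ideal q \<and> deriv f \<in> form_ideal q}"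
  note expand = lin_ext_linear lin_ext_mon mult.assoc mon_mult mon_Nil
  have "form_ideal q \<subseteq> K"
    unfolding form_ideal_def
  proof (rule generated_subset_ideal)
    show "ideal K free_algebra"
      by (rule idealI_free_algebra)
        (auto simp: K_def lin_ext_linear sign_mult deriv_leibniz form_closed)
    have s: "sign f = f \<or> sign f = - f" if "f \<in> form_relations q" for f
      using that by (auto simp: form_relations_def expand)
    have "deriv (gp * gx - rscalar q * gx * gp) =
        (gp * gdx - (rscalar q * gdx * gp + rscalar (q^2 - 1) * gdp * gx))
        - rscalar q * (gx * gdp - rscalar q * gdp * gx)"
      by (simp add: expand free_simps power2_eq_square)
    moreover have "deriv (gx * gdp - rscalar q * gdp * gx) =
        rscalar q * (gdp * gdx - rscalar (- inverse q) * gdx * gdp)"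
      using assms(1) by (simp add: expand free_simps power2_eq_square)
    moreover have "deriv (gp * gdx - (rscalar q * gdx * gp + rscalar (q^2 - 1) * gdp * gx)) =
        rscalar (q^2) * (gdp * gdx - rscalar (- inverse q) * gdx * gdp)"
      using assms(1) by (simp add: expand free_simps power2_eq_square)
    moreover have "deriv (gx * gdx - rscalar (q^2) * gdx * gx) = rscalar (1 + q^2) * (gdx * gdx)"
      by (simp add: expand free_simps)
    moreover have "deriv (gp * gdp - rscalar (q^2) * gdp * gp) = rscalar (1 + q^2) * (gdp * gdp)"
      by (simp add: expand free_simps)
    moreover have "deriv (gdp * gdx - rscalar (- inverse q) * gdx * gdp) = 0"
      "deriv (gdx * gdx) = 0" "deriv (gdp * gdp) = 0"
      by (simp_all add: expand free_simps)
    ultimately have d: "deriv f \<in> form_ideal q" if "f \<in> form_relations q" for f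
      using that r unfolding form_relations_def
      by (elim insertE emptyE) (simp_all only: c simp_thms)
    show "form_relations q \<subseteq> K"
    proof
      fix f assume f: "f \<in> form_relations q"
      then have "f \<in> form_ideal q"
        unfolding form_ideal_def by (rule generators_in_ideal)
      moreover from this have "sign f \<in> form_ideal q"
        using s[OF f] form_closed(5)[where f = f and q = q] by auto
      ultimately show "f \<in> K"
        using d[OF f] by (simp add: K_def)
    qed
  qed
  with assms show ?thesis by (auto simp: K_def)
qed

text \<open>Moving a coordinate from the left past \<open>dx\<close> and \<open>dp\<close> produces the terms that moving
  \<open>\<partial>\<^sub>x\<close> and \<open>\<partial>\<^sub>p\<close> past that coordinate does; the difference of the two sides for \<open>g # w\<close> is
  therefore a multiple of the difference for \<open>w\<close> plus multiples of relations.\<close>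

lemma deriv_incl:
  "deriv (incl f) - (gdx * incl (lin_ext (dx_word q) f) + gdp * incl (lin_ext (dp_word q) f))
    \<in> form_ideal q"
proof (induction f rule: free_induct)
  case (add f g)
  from form_closed(2)[OF this] show ?case
    by (simp add: lin_ext_linear algebra_simps)
next
  case (scale c f)
  from form_closed(3)[OF this, where h = "scalar c"] show ?case
    by (simp add: lin_ext_linear right_diff_distrib distrib_left scalar_left_commute)
next
  case (mon w)
  note r = form_relations_in_ideal[of q]
  have "d_word (map Co w) - (gdx * incl (dx_word q w) + gdp * incl (dp_word q w)) \<in> form_ideal q"
  proof (induction w)
    case Nil
    show ?case by (simp add: lin_ext_linear form_closed)
  next
    case (Cons g w)
    define D A B where D: "D = d_word (map Co w)"
      and A: "A = incl (dx_word q w)" and B: "B = incl (dp_word q w)"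
    note IH = Cons.IH[folded D A B]
    note expand = lin_ext_linear incl_mult incl_scalar lin_ext_mon
    show ?case
    proof (cases g)
      case X
      have "d_word (map Co (g # w))
            - (gdx * incl (dx_word q (g # w)) + gdp * incl (dp_word q (g # w))) =
          gx * (D - (gdx * A + gdp * B)) + (gx * gdx - rscalar (q^2) * gdx * gx) * A
            + (gx * gdp - rscalar q * gdp * gx) * B"
        by (simp add: X D A B expand free_simps)
      also have "\<dots> \<in> form_ideal q"
        by (intro form_closed(2,3,4) IH r)
      finally show ?thesis .
    next
      case P
      have "d_word (map Co (g # w))
            - (gdx * incl (dx_word q (g # w)) + gdp * incl (dp_word q (g # w))) =
          gp * (D - (gdx * A + gdp * B))
            + (gp * gdx - (rscalar q * gdx * gp + rscalar (q^2 - 1) * gdp * gx)) * A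
            + (gp * gdp - rscalar (q^2) * gdp * gp) * B"
        by (simp add: P D A B expand free_simps)
      also have "\<dots> \<in> form_ideal q"
        by (rule form_closed(2)[OF form_closed(2)[OF form_closed(3)[OF IH]
              form_closed(4)[OF r(3)]] form_closed(4)[OF r(5)]])
      finally show ?thesis .
    qed
  qed
  then show ?case by (simp add: lin_ext_mon)
qed

section \<open>The forms are a free right module\<close>

text \<open>The indices of \<open>1\<close>, \<open>dx\<close>, \<open>dp\<close> and \<open>dx \<and> dp\<close>.\<close>

datatype basis = B1 | BX | BP | BXP

lemma UNIV_basis: "UNIV = {B1, BX, BP, BXP}"
  by (auto intro: basis.exhaust)

text \<open>Column \<open>j\<close> holds the coefficients of the product of the generator \<open>g\<close> with the basis form \<open>j\<close>,
  after the differentials have been moved to the left by the relations.  For example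
  \<open>p dx = dx (q p) + dp ((q\<^sup>2 - 1) x)\<close> gives the off-diagonal entry of \<open>p\<close>.\<close>

definition left_mult :: "real \<Rightarrow> form_gen \<Rightarrow> basis \<Rightarrow> basis \<Rightarrow> coord free" where
  "left_mult q g i j = (case g of
      Co X \<Rightarrow> if i = j
        then rscalar (case i of B1 \<Rightarrow> 1 | BX \<Rightarrow> q^2 | BP \<Rightarrow> q | BXP \<Rightarrow> q^3) * gen X else 0
    | Co P \<Rightarrow> if i = j
        then rscalar (case i of B1 \<Rightarrow> 1 | BX \<Rightarrow> q | BP \<Rightarrow> q^2 | BXP \<Rightarrow> q^3) * gen P
        else if i = BP \<and> j = BX then rscalar (q^2 - 1) * gen X else 0
    | Di X \<Rightarrow> if i = BX \<and> j = B1 \<or> i = BXP \<and> j = BP then 1 else 0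
    | Di P \<Rightarrow> if i = BP \<and> j = B1 then 1
        else if i = BXP \<and> j = BX then rscalar (- inverse q) else 0)"

primrec mat_word :: "real \<Rightarrow> form_gen list \<Rightarrow> basis \<Rightarrow> basis \<Rightarrow> coord free" where
  "mat_word q [] = (\<lambda>i j. if i = j then 1 else 0)"
| "mat_word q (g # w) = (\<lambda>i j. \<Sum>k\<in>UNIV. left_mult q g i k * mat_word q w k j)"

definition mat :: "real \<Rightarrow> form_gen free \<Rightarrow> basis \<Rightarrow> basis \<Rightarrow> coord free" where
  "mat q f i j = lin_ext (\<lambda>w. mat_word q w i j) f"

lemma mat_linear:
  "mat q (f + g) i j = mat q f i j + mat q g i j"
  "mat q (scalar c * f) i j = scalar c * mat q f i j"
  "mat q 0 i j = 0"
  "mat q (- f) i j = - mat q f i j"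
  "mat q (f - g) i j = mat q f i j - mat q g i j"
  by (simp_all add: mat_def lin_ext_linear)

lemma mat_mon: "mat q (mon w) i j = mat_word q w i j"
  by (simp add: mat_def lin_ext_mon)

lemma sum_basis: "(\<Sum>k\<in>UNIV. F k) = F B1 + F BX + F BP + F BXP"
  for F :: "basis \<Rightarrow> 'a free"
  by (simp add: UNIV_basis add.assoc)

lemma mat_gen: "mat q (gen g) i j = left_mult q g i j"
  by (cases j) (simp_all add: mat_mon sum_basis)

lemma mat_mult: "mat q (f * g) i j = (\<Sum>k\<in>UNIV. mat q f i k * mat q g k j)"
proof (induction f rule: free_induct)
  case (mon u)
  show ?case
  proof (induction g rule: free_induct)
    case (mon v)
    have "mat_word q (u @ v) i j = (\<Sum>k\<in>UNIV. mat_word q u i k * mat_word q v k j)"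
    proof (induction u arbitrary: i)
      case Nil
      show ?case by (cases i) (simp_all add: sum_basis)
    next
      case (Cons g u)
      show ?case
        by (simp add: Cons.IH) (simp add: sum_basis distrib_left distrib_right mult.assoc)
    qed
    then show ?case
      by (simp add: mon_mult mat_mon)
  qed (simp_all add: mat_linear sum_basis distrib_left scalar_left_commute)
qed (simp_all add: mat_linear sum_basis distrib_left distrib_right mult.assoc)

lemma mat_scalar: "mat q (scalar c) i j = (if i = j then scalar c else 0)"
  using mat_linear(2)[of q c 1 i j] by (simp add: mat_def lin_ext_one)

text \<open>The matrices satisfy the defining relations of the forms: those involving
  differentials hold already over the free algebra, and for \<open>p x - q x p\<close> the result is a
  diagonal matrix with entries in the ideal of the quantum plane.\<close>

lemma mat_form_ideal:
  assumes "q \<noteq> 0" "f \<in> form_ideal q"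
  shows "mat q f i j \<in> plane_ideal q"
proof -
  define K where "K = {f. \<forall>i j. mat q f i j \<in> plane_ideal q}"
  have "form_ideal q \<subseteq> K"
    unfolding form_ideal_def
  proof (rule generated_subset_ideal)
    show "ideal K free_algebra"
      by (rule idealI_free_algebra)
        (auto simp: K_def mat_linear mat_mult sum_basis plane_closed)
    have px: "gen P * gen X - rscalar q * gen X * gen P \<in> plane_ideal q"
      unfolding plane_ideal_def by (rule generators_in_ideal) simp
    note expand = mat_linear mat_mult mat_gen mat_scalar sum_basis mult.assoc left_mult_def
    have cancel: "complex_of_real q * (inverse (complex_of_real q) * y) = y"
      "inverse (complex_of_real q) * (complex_of_real q * y) = y" for y
      using assms(1) by (simp_all flip: mult.assoc)
    \<comment> \<open>The off-diagonal entry of \<open>p\<close> is a multiple of \<open>x\<close>; its contributions to \<open>p x\<close> and \<open>q x p\<close>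
      agree because the weights of \<open>x\<close> on \<open>dx\<close> and \<open>dp\<close> are \<open>q\<^sup>2\<close> and \<open>q\<close>.\<close>
    have "mat q (gp * gx - rscalar q * gx * gp) i j =
        (if i = j then rscalar (case i of B1 \<Rightarrow> 1 | BX \<Rightarrow> q^3 | BP \<Rightarrow> q^3 | BXP \<Rightarrow> q^6) else 0)
         * (gen P * gen X - rscalar q * gen X * gen P)" for i j
      by (cases i; cases j)
        (simp_all only: mult.assoc mat_linear, simp_all add: expand free_simps power_numeral_reduce)
    then have "mat q (gp * gx - rscalar q * gx * gp) i j \<in> plane_ideal q" for i j
      by (simp only: plane_closed(3)[OF px])
    moreover have "mat q f i j = 0"
      if "f \<in> form_relations q" "f \<noteq> gp * gx - rscalar q * gx * gp" for f i j
      using that assms(1) unfolding form_relations_def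
      by (elim insertE emptyE; cases i; cases j)
        (simp_all only: mult.assoc mat_linear,
         simp_all add: expand free_simps power_numeral_reduce cancel)
    ultimately show "form_relations q \<subseteq> K"
      using plane_closed(1)[of q] unfolding K_def by force
  qed
  with assms show ?thesis by (auto simp: K_def)
qed

lemma mat_incl: "mat q (incl f) i B1 = (if i = B1 then f else 0)"
proof (induction f arbitrary: i rule: free_induct)
  case (mon w)
  have "mat_word q (map Co w) i B1 = (if i = B1 then mon w else 0)"
  proof (induction w arbitrary: i)
    case Nil
    show ?case by (simp add: mon_Nil)
  next
    case (Cons g w)
    show ?case
      by (cases g; cases i) (simp_all add: Cons.IH sum_basis left_mult_def mon_mult)
  qed
  then show ?case by (simp add: lin_ext_mon mat_mon)
qed (simp_all add: lin_ext_linear mat_linear)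

definition form_rep ::
    "coord free \<Rightarrow> coord free \<Rightarrow> coord free \<Rightarrow> coord free \<Rightarrow> form_gen free" where
  "form_rep e f g h = incl e + gdx * incl f + gdp * incl g + gdx * gdp * incl h"

text \<open>The first column of the matrix of a form in normal form consists of its coefficients, as they
  are obtained by applying the form to the basis element \<open>1\<close>.\<close>

lemma form_rep_in_ideal_iff:
  assumes "q \<noteq> 0"
  shows "form_rep e f g h \<in> form_ideal q \<longleftrightarrow>
    e \<in> plane_ideal q \<and> f \<in> plane_ideal q \<and> g \<in> plane_ideal q \<and> h \<in> plane_ideal q"
    (is "_ \<longleftrightarrow> ?coefficients")
proof
  assume *: "form_rep e f g h \<in> form_ideal q"
  have "mat q (form_rep e f g h) i B1 = (case i of B1 \<Rightarrow> e | BX \<Rightarrow> f | BP \<Rightarrow> g | BXP \<Rightarrow> h)" for i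
    by (cases i) (simp_all add: form_rep_def mat_linear mat_mult mat_gen mat_incl sum_basis
        left_mult_def)
  then show ?coefficients
    using mat_form_ideal[OF assms *, of B1 B1] mat_form_ideal[OF assms *, of BX B1]
      mat_form_ideal[OF assms *, of BP B1] mat_form_ideal[OF assms *, of BXP B1] by simp
next
  assume ?coefficients
  then show "form_rep e f g h \<in> form_ideal q"
    unfolding form_rep_def by (intro form_closed(2,3) incl_plane_ideal) auto
qed

section \<open>The calculus on classes\<close>

text \<open>If \<open>f\<close> is in the ideal of the quantum plane, the form \<open>df\<close> is zero, and by freeness its
  coefficients vanish.\<close>

lemma partials_plane_ideal:
  assumes "q \<noteq> 0" "f \<in> plane_ideal q"
  shows "lin_ext (dx_word q) f \<in> plane_ideal q" "lin_ext (dp_word q) f \<in> plane_ideal q"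
proof -
  let ?D = "gdx * incl (lin_ext (dx_word q) f) + gdp * incl (lin_ext (dp_word q) f)"
  have "deriv (incl f) - (deriv (incl f) - ?D) \<in> form_ideal q"
    by (intro form_closed(6) deriv_form_ideal incl_plane_ideal deriv_incl assms)
  then have "form_rep 0 (lin_ext (dx_word q) f) (lin_ext (dp_word q) f) 0 \<in> form_ideal q"
    by (simp add: form_rep_def lin_ext_linear add.commute)
  then show "lin_ext (dx_word q) f \<in> plane_ideal q" "lin_ext (dp_word q) f \<in> plane_ideal q"
    by (simp_all add: form_rep_in_ideal_iff assms)
qed

lemmas plane_ops = quotient_operations[OF plane_ideal, folded plane_def]
lemmas plane_carrier = carrier_quotient[of "plane_ideal q" for q, folded plane_def]
lemmas form_ops = quotient_operations[OF form_ideal, folded forms_def]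

lemma partial_x_cls:
  "q \<noteq> 0 \<Longrightarrow> partial_x q (cls (plane_ideal q) f) = cls (plane_ideal q) (lin_ext (dx_word q) f)"
  unfolding partial_x_def by (intro quot_map_cls plane_ideal partials_plane_ideal)

lemma partial_p_cls:
  "q \<noteq> 0 \<Longrightarrow> partial_p q (cls (plane_ideal q) f) = cls (plane_ideal q) (lin_ext (dp_word q) f)"
  unfolding partial_p_def by (intro quot_map_cls plane_ideal partials_plane_ideal)

lemma zero_form_cls: "zero_form q (cls (plane_ideal q) f) = form_class q (incl f)"
  unfolding zero_form_def form_class_def
  by (intro quot_map_cls plane_ideal form_ideal incl_plane_ideal)

lemma ext_d_cls: "q \<noteq> 0 \<Longrightarrow> ext_d q (form_class q f) = form_class q (deriv f)"
  unfolding ext_d_def form_class_def by (intro quot_map_cls form_ideal deriv_form_ideal)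

lemma form_class_ops:
  "form_class q f \<otimes>\<^bsub>forms q\<^esub> form_class q g = form_class q (f * g)"
  "form_class q f \<oplus>\<^bsub>forms q\<^esub> form_class q g = form_class q (f + g)"
  "\<zero>\<^bsub>forms q\<^esub> = form_class q 0"
  by (simp_all add: form_class_def form_ops)

lemma deriv_incl_cls:
  "form_class q (deriv (incl f)) =
    form_class q (form_rep 0 (lin_ext (dx_word q) f) (lin_ext (dp_word q) f) 0)"
  using deriv_incl[of f q]
  by (simp add: form_class_def cls_eq_iff[OF form_ideal] form_rep_def lin_ext_linear)

lemma decomposition_cls:
  "zero_form q (cls (plane_ideal q) e) \<oplus>\<^bsub>forms q\<^esub>
     one_form q (cls (plane_ideal q) f) (cls (plane_ideal q) g) \<oplus>\<^bsub>forms q\<^esub>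
     two_form q (cls (plane_ideal q) h) = form_class q (form_rep e f g h)"
  by (simp add: one_form_def two_form_def zero_form_cls form_class_ops form_rep_def add.assoc)

lemma form_class_form_rep_eq_iff:
  assumes "q \<noteq> 0"
  shows "form_class q (form_rep e f g h) = form_class q (form_rep e' f' g' h') \<longleftrightarrow>
    e - e' \<in> plane_ideal q \<and> f - f' \<in> plane_ideal q \<and>
    g - g' \<in> plane_ideal q \<and> h - h' \<in> plane_ideal q"
proof -
  have *: "form_rep e f g h - form_rep e' f' g' h' =
      form_rep (e - e') (f - f') (g - g') (h - h')"
    by (simp add: form_rep_def lin_ext_linear algebra_simps)
  show ?thesis
    by (simp add: form_class_def cls_eq_iff[OF form_ideal] * form_rep_in_ideal_iff[OF assms])
qed

text \<open>Normal form coefficients of a form are unique modulo the ideal of the quantum plane, and the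
  contraction depends on them additively, so the description in the definition has exactly one
  solution.\<close>

lemma interior_cls:
  assumes "q \<noteq> 0"
  shows "interior q (cls (plane_ideal q) a, cls (plane_ideal q) b)
      (form_class q (form_rep e f g h)) =
    form_class q (form_rep (a * f + b * g) (- (b * h)) (rscalar q * a * h) 0)"
proof -
  let ?c = "cls (plane_ideal q)"
  let ?contr = "\<lambda>f g h. form_class q (form_rep (a * f + b * g) (- (b * h)) (rscalar q * a * h) 0)"
  have contr: "zero_form q ((?c a \<otimes>\<^bsub>plane q\<^esub> ?c f) \<oplus>\<^bsub>plane q\<^esub> (?c b \<otimes>\<^bsub>plane q\<^esub> ?c g)) \<oplus>\<^bsub>forms q\<^esub>
      one_form q (\<ominus>\<^bsub>plane q\<^esub> (?c b \<otimes>\<^bsub>plane q\<^esub> ?c h))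
        (plane_scalar q q \<otimes>\<^bsub>plane q\<^esub> ?c a \<otimes>\<^bsub>plane q\<^esub> ?c h) = ?contr f g h" for f g h
    by (simp add: plane_ops plane_scalar_def one_form_def zero_form_cls form_class_ops
        form_rep_def lin_ext_linear algebra_simps)
  have unique: "?contr f' g' h' = ?contr f g h"
    if "form_class q (form_rep e f g h) = form_class q (form_rep e' f' g' h')" for e' f' g' h'
  proof -
    have *: "f' - f \<in> plane_ideal q" "g' - g \<in> plane_ideal q" "h' - h \<in> plane_ideal q"
      using that[symmetric] by (simp_all add: form_class_form_rep_eq_iff[OF assms])
    have "a * (f' - f) + b * (g' - g) \<in> plane_ideal q" "- (b * (h' - h)) \<in> plane_ideal q"
      "rscalar q * a * (h' - h) \<in> plane_ideal q"
      by (intro plane_closed(2,3,5) *)+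
    then show ?thesis
      by (simp add: form_class_form_rep_eq_iff[OF assms] plane_closed algebra_simps)
  qed
  have "interior q (?c a, ?c b) (form_class q (form_rep e f g h)) =
      (THE \<theta>. \<exists>e' f' g' h'. form_class q (form_rep e f g h) = form_class q (form_rep e' f' g' h')
        \<and> \<theta> = ?contr f' g' h')"
    unfolding interior_def by (simp add: plane_carrier contr decomposition_cls)
  also have "\<dots> = ?contr f g h"
    using unique by (intro the_equality) blast+
  finally show ?thesis .
qed

section \<open>Hamiltonian fields preserve the symplectic form\<close>

theorem theorem1:
  fixes q :: real and H :: "coord free set"
  assumes "q > 0"
    and "H \<in> carrier (plane q)"
  shows "lie_derivative q (hamiltonian_field q H) (symplectic_form q) = \<zero>\<^bsub>forms q\<^esub>"
proof -
  have q: "q \<noteq> 0" using assms(1) by simp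
  let ?c = "cls (plane_ideal q)"
  define s t where s: "s = q powr (- 1/2)" and t: "t = q powr (1/2)"
  obtain f where H: "H = ?c f"
    using assms(2) by (auto simp: plane_carrier)
  define dx dp where dx: "dx = lin_ext (dx_word q) f" and dp: "dp = lin_ext (dp_word q) f"
  have field: "hamiltonian_field q H = (?c (rscalar s * dp), ?c (- (rscalar t * dx)))"
    by (simp add: hamiltonian_field_def H partial_x_cls[OF q] partial_p_cls[OF q] plane_scalar_def
        plane_ops dx dp s t)
  have omega: "symplectic_form q = form_class q (form_rep 0 0 0 (rscalar s))"
    by (simp add: symplectic_form_def form_class_ops form_rep_def lin_ext_linear incl_scalar
        free_simps s)
  have st: "t * s = 1" "q * (s * s) = 1"
    using assms(1) by (simp_all flip: powr_add add: powr_minus divide_simps s t)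
  have "interior q (hamiltonian_field q H) (symplectic_form q) = form_class q (form_rep 0 dx dp 0)"
    by (simp add: field omega interior_cls[OF q] free_simps scalar_central[of dx]
        scalar_central[of dp] mult.assoc st flip: of_real_mult)
  also have "\<dots> = form_class q (deriv (incl f))"
    by (simp add: deriv_incl_cls dx dp)
  finally have "ext_d q (interior q (hamiltonian_field q H) (symplectic_form q)) = form_class q 0"
    by (simp add: ext_d_cls[OF q] deriv_deriv)
  moreover have "ext_d q (symplectic_form q) = form_class q (form_rep 0 0 0 0)"
    by (simp add: omega ext_d_cls[OF q] form_rep_def lin_ext_linear incl_scalar mult.assoc
        deriv_gen_Di deriv_scalar)
  then have "interior q (hamiltonian_field q H) (ext_d q (symplectic_form q)) = form_class q 0"
    by (simp add: field interior_cls[OF q]) (simp add: form_rep_def lin_ext_linear)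
  ultimately show ?thesis
    by (simp add: lie_derivative_def form_class_ops)
qed

end
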